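(* Let $(X,d,\preceq)$ be an ordered metric space, $F:X^{n}\to X$ a mapping and $\ast\in\mathcal{U}_{\iota_n}$. Let $E$ be an O-complete subspace of $X$ such that $F(X^n)\subseteq E$. Suppose that the following conditions (i)-(iii) hold: (i) $F$ has the $\iota_n$-mixed monotone property; (ii) either $F$ is O-continuous or $(E,d,\preceq)$ has the MCB property; (iii) there exist $x^{(0)}_1,\dots,x^{(0)}_n\in X$ such that either [$x^{(0)}_i\preceq F(x^{(0)}_{i_1},\dots,x^{(0)}_{i_n})$ for each $i\in A$ and $x^{(0)}_i\succeq F(x^{(0)}_{i_1},\dots,x^{(0)}_{i_n})$ for each $i\in B$], or [$x^{(0)}_i\succeq F(x^{(0)}_{i_1},\dots,x^{(0)}_{i_n})$ for each $i\in A$ and $x^{(0)}_i\preceq F(x^{(0)}_{i_1},\dots,x^{(0)}_{i_n})$ for each $i\in B$]. Suppose moreover that at least one of the following two conditions holds: (iv) there exists $\varphi\in\Omega$ such that $$\frac1n\sum_{i=1}^n d\big(F(x_{i_1},\dots,x_{i_n}),F(y_{i_1},\dots,y_{i_n})\big)\le\varphi\Big(\frac1n\sum_{i=1}^n d(x_i,y_i)\Big)$$ for all $x_1,\dots,x_n,y_1,\dots,y_n\in X$ with [$x_i\preceq y_i$ for each $i\in A$ and $x_i\succeq y_i$ for each $i\in B$] or [$x_i\succeq y_i$ for each $i\in A$ and $x_i\preceq y_i$ for each $i\in B$]; (iv$'$) there exists $\varphi\in\Omega$ such that $$\max_{i\in I_n} d\big(F(x_{i_1},\dots,x_{i_n}),F(y_{i_1},\dots,y_{i_n})\big)\le\varphi\Big(\max_{i\in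 I_n} d(x_i,y_i)\Big)$$ for all $x_1,\dots,x_n,y_1,\dots,y_n\in X$ with [$x_i\preceq y_i$ for each $i\in A$ and $x_i\succeq y_i$ for each $i\in B$] or [$x_i\succeq y_i$ for each $i\in A$ and $x_i\preceq y_i$ for each $i\in B$]. Then $F$ has an $\ast$-fixed point.
   Context: Fix an integer $n\ge 2$, put $I_n=\{1,\dots,n\}$, and let $\iota_n=\{A,B\}$ be a fixed partition of $I_n$ into two nonempty disjoint subsets $A,B$. For a binary operation $\ast:I_n\times I_n\to I_n$ write $i_k:=\ast(i,k)$. $\mathcal{U}_{\iota_n}$ is the set of all binary operations $\ast$ on $I_n$ with $\ast(A\times A)\subseteq A$, $\ast(A\times B)\subseteq B$, $\ast(B\times A)\subseteq B$, $\ast(B\times B)\subseteq A$. An ordered metric space $(X,d,\preceq)$ is a nonempty set $X$ with a metric $d$ and a partial order $\preceq$; $x\succeq y$ means $y\preceq x$. A subspace is a nonempty subset with the restricted metric and order. Sequences are indexed by $m\in\mathbb{N}_0=\{0,1,2,\dots\}$. A sequence is increasing (decreasing) if $x^{(m)}\preceq x^{(l)}$ ($x^{(m)}\succeq x^{(l)}$) whenever $m<l$, and monotone if it is increasing or decreasing. $x^{(m)}\uparrow x$ (resp. $\downarrow x$, $\uparrow\downarrow x$) means $\{x^{(m)}\}$ is increasing (resp. decreasing, monotone) and converges to $x$ in $d$. An ordered metric space is O-complete if every monotone Cauchy sequence in it converges in it. $F:X^n\to X$ has the $\iota_n$-mixed monotone property if, with all other arguments fixed arbitrarily, $\underline{x}_i\preceq\overline{x}_i$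 implies $F(\dots,\underline{x}_i,\dots)\preceq F(\dots,\overline{x}_i,\dots)$ ($i$-th argument) when $i\in A$, and $F(\dots,\underline{x}_i,\dots)\succeq F(\dots,\overline{x}_i,\dots)$ when $i\in B$. $F$ is O-continuous if $x_i^{(m)}\uparrow\downarrow x_i$ for all $i\in I_n$ implies $F(x_1^{(m)},\dots,x_n^{(m)})\to F(x_1,\dots,x_n)$. $(E,d,\preceq)$ has the MCB property if for every sequence $\{x^{(m)}\}$ in $E$ and $x\in E$: $x^{(m)}\uparrow x$ implies $x^{(m)}\preceq x$ for all $m$, and $x^{(m)}\downarrow x$ implies $x^{(m)}\succeq x$ for all $m$. $\Omega$ is the set of functions $\varphi:[0,\infty)\to[0,\infty)$ with $\varphi(t)<t$ and $\limsup_{r\to t^+}\varphi(r)<t$ for every $t>0$. An $\ast$-fixed point of $F$ is $(x_1,\dots,x_n)\in X^n$ with $F(x_{i_1},\dots,x_{i_n})=x_i$ for each $i\in I_n$. *)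

theory Defs
  imports "HOL-Analysis.Analysis"
begin

text \<open>
  The finite type \<open>'n\<close> plays the role of the index set \<open>I\<^sub>n\<close>, with \<open>n = CARD('n)\<close>, and a point of
  \<open>X\<^sup>n\<close> is a function \<open>'n \<Rightarrow> 'a\<close>.  The ordered metric space \<open>X\<close> is a type \<open>'a\<close> of sorts
  \<open>metric_space\<close> and \<open>order\<close>; no compatibility between metric and order is assumed.
\<close>

definition index_partition :: "'n set \<Rightarrow> 'n set \<Rightarrow> bool" where
  "index_partition A B \<longleftrightarrow> A \<noteq> {} \<and> B \<noteq> {} \<and> A \<inter> B = {} \<and> A \<union> B = UNIV"

definition U_ops :: "'n set \<Rightarrow> 'n set \<Rightarrow> ('n \<Rightarrow> 'n \<Rightarrow> 'n) set" where
  "U_ops A B = {star.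
     (\<forall>i\<in>A. \<forall>k\<in>A. star i k \<in> A) \<and> (\<forall>i\<in>A. \<forall>k\<in>B. star i k \<in> B) \<and>
     (\<forall>i\<in>B. \<forall>k\<in>A. star i k \<in> B) \<and> (\<forall>i\<in>B. \<forall>k\<in>B. star i k \<in> A)}"

definition O_complete :: "'a::{metric_space, order} set \<Rightarrow> bool" where
  "O_complete E \<longleftrightarrow>
     (\<forall>x. (\<forall>m. x m \<in> E) \<and> monoseq x \<and> Cauchy x \<longrightarrow> (\<exists>l\<in>E. x \<longlonglongrightarrow> l))"

definition MCB_property :: "'a::{metric_space, order} set \<Rightarrow> bool" where
  "MCB_property E \<longleftrightarrow>
     (\<forall>x. \<forall>l\<in>E. (\<forall>m. x m \<in> E) \<and> x \<longlonglongrightarrow> l \<longrightarrow>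
        (incseq x \<longrightarrow> (\<forall>m. x m \<le> l)) \<and> (decseq x \<longrightarrow> (\<forall>m. l \<le> x m)))"

definition mixed_monotone :: "'n set \<Rightarrow> 'n set \<Rightarrow> (('n \<Rightarrow> 'a::order) \<Rightarrow> 'a) \<Rightarrow> bool" where
  "mixed_monotone A B F \<longleftrightarrow>
     (\<forall>x u v. u \<le> v \<longrightarrow>
        (\<forall>i\<in>A. F (x(i := u)) \<le> F (x(i := v))) \<and>
        (\<forall>i\<in>B. F (x(i := v)) \<le> F (x(i := u))))"

text \<open>The family \<open>x\<close> consists of one sequence \<open>x i\<close> for each coordinate \<open>i\<close>; some coordinates may be
  increasing and others decreasing.\<close>

definition O_continuous :: "(('n \<Rightarrow> 'a::{metric_space, order}) \<Rightarrow> 'a) \<Rightarrow> bool" where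
  "O_continuous F \<longleftrightarrow>
     (\<forall>(x :: 'n \<Rightarrow> nat \<Rightarrow> 'a) l. (\<forall>i. monoseq (x i) \<and> x i \<longlonglongrightarrow> l i) \<longrightarrow>
        (\<lambda>m. F (\<lambda>i. x i m)) \<longlonglongrightarrow> F l)"

text \<open>Functions \<open>[0,\<infinity>) \<rightarrow> [0,\<infinity>)\<close> are total functions on the reals whose values at negative arguments
  are irrelevant.  The upper limit is taken in the extended reals, so that it always exists.\<close>

definition Omega :: "(real \<Rightarrow> real) set" where
  "Omega = {\<phi>. (\<forall>t\<ge>0. 0 \<le> \<phi> t) \<and>
     (\<forall>t>0. \<phi> t < t \<and> Limsup (at_right t) (\<lambda>r. ereal (\<phi> r)) < ereal t)}"

definition mixed_le :: "'n set \<Rightarrow> 'n set \<Rightarrow> ('n \<Rightarrow> 'a::order) \<Rightarrow> ('n \<Rightarrow> 'a) \<Rightarrow> bool" where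
  "mixed_le A B x y \<longleftrightarrow> (\<forall>i\<in>A. x i \<le> y i) \<and> (\<forall>i\<in>B. y i \<le> x i)"

definition star_map :: "('n \<Rightarrow> 'n \<Rightarrow> 'n) \<Rightarrow> (('n \<Rightarrow> 'a) \<Rightarrow> 'a) \<Rightarrow> ('n \<Rightarrow> 'a) \<Rightarrow> 'n \<Rightarrow> 'a" where
  "star_map star F x i = F (\<lambda>k. x (star i k))"

definition star_fixed_point :: "('n \<Rightarrow> 'n \<Rightarrow> 'n) \<Rightarrow> (('n \<Rightarrow> 'a) \<Rightarrow> 'a) \<Rightarrow> ('n \<Rightarrow> 'a) \<Rightarrow> bool" where
  "star_fixed_point star F x \<longleftrightarrow> (\<forall>i. F (\<lambda>k. x (star i k)) = x i)"

end

theory Submission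
  imports Defs
begin

text \<open>
  The map \<open>T = star_map star F\<close> is monotone for the order \<open>mixed_le A B\<close> on \<open>X\<^sup>n\<close>, so the iterates of
  \<open>x0\<close> form a monotone sequence.  For either product metric \<open>D\<close> (mean or maximum), membership of
  \<open>\<phi>\<close> in \<open>Omega\<close> turns the contraction condition into one of Meir--Keeler type: for every
  \<open>\<epsilon> > 0\<close> there is \<open>\<delta> > 0\<close> such that comparable points at distance below \<open>\<epsilon> + \<delta>\<close> have images at
  distance below \<open>\<epsilon>\<close>.  This makes the iterates Cauchy, and their limit is a fixed point of \<open>T\<close>,
  either by O-continuity or because the MCB property makes the limit comparable to the iterates.
\<close>

section \<open>Meir-Keeler conditions and Cauchy orbits\<close>

text \<open>Up to and including \<open>\<epsilon>\<close> the bound \<open>\<phi> r < r\<close>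
  suffices; just to the right of it the upper limit keeps \<open>\<phi>\<close> below
  \<open>\<epsilon>\<close>. Membership in \<open>Omega\<close> allows \<open>\<phi> 0 > 0\<close>,
  hence the restriction \<open>0 < r\<close>.\<close>

lemma Omega_Meir_Keeler:
  assumes "\<phi> \<in> Omega" "\<epsilon> > 0"
  obtains \<delta> where "\<delta> > 0" "\<And>r. 0 < r \<Longrightarrow> r < \<epsilon> + \<delta> \<Longrightarrow> \<phi> r < \<epsilon>"
proof -
  have lt: "\<phi> t < t" if "t > 0" for t
    using assms(1) that by (auto simp: Omega_def)
  have "Limsup (at_right \<epsilon>) (\<lambda>r. ereal (\<phi> r)) < ereal \<epsilon>"
    using assms by (auto simp: Omega_def)
  then have "\<forall>\<^sub>F r in at_right \<epsilon>. ereal (\<phi> r) < ereal \<epsilon>"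
    by (rule Limsup_lessD)
  then obtain b where b: "b > \<epsilon>" "\<And>r. \<epsilon> < r \<Longrightarrow> r < b \<Longrightarrow> \<phi> r < \<epsilon>"
    unfolding eventually_at_right_field by auto
  show thesis
  proof
    show "b - \<epsilon> > 0" using b(1) by simp
    show "\<phi> r < \<epsilon>" if "0 < r" "r < \<epsilon> + (b - \<epsilon>)" for r
      using lt[of r] b(2)[of r] that by (cases r \<epsilon> rule: linorder_cases) auto
  qed
qed

text \<open>Consecutive distances decrease to 0; once they are small, a ball around some
  \<open>z N\<close> traps the rest of the orbit. Only pairs with \<open>m \<le> k\<close> enter
  \<open>MK\<close>, because the contraction is available only for comparable points.\<close>

lemma Meir_Keeler_orbit_Cauchy:
  fixes D :: "'b \<Rightarrow> 'b \<Rightarrow> real" and z :: "nat \<Rightarrow> 'b"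
  assumes nonneg: "\<And>x y. 0 \<le> D x y"
    and refl: "\<And>x. D x x = 0"
    and triangle: "\<And>x y w. D x w \<le> D x y + D y w"
    and MK: "\<And>\<epsilon>. \<epsilon> > 0 \<Longrightarrow> \<exists>\<delta>>0. \<forall>m k. m \<le> k \<longrightarrow> D (z m) (z k) < \<epsilon> + \<delta> \<longrightarrow>
               D (z (Suc m)) (z (Suc k)) < \<epsilon>"
    and "\<epsilon> > 0"
  shows "\<exists>N. \<forall>k\<ge>N. D (z N) (z k) < \<epsilon>"
proof -
  define a where "a m = D (z m) (z (Suc m))" for m
  have a_nonneg: "0 \<le> a m" for m by (simp add: a_def nonneg)
  have a_step: "\<exists>\<delta>>0. \<forall>m. a m < e + \<delta> \<longrightarrow> a (Suc m) < e" if "e > 0" for e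
    using MK[OF that] by (metis a_def le_SucI order_refl)
  have "a (Suc m) \<le> a m" for m
  proof (rule ccontr)
    assume *: "\<not> a (Suc m) \<le> a m"
    then have "a (Suc m) > 0" using a_nonneg[of m] by simp
    \<comment> \<open>The threshold is \<open>a (Suc m)\<close> itself: an increase would give
      \<open>a m < a (Suc m) + \<delta>\<close> and so the absurd strict inequality.\<close>
    then obtain \<delta> where "\<delta> > 0" "a m < a (Suc m) + \<delta> \<longrightarrow> a (Suc m) < a (Suc m)"
      using a_step by blast
    then show False using * by simp
  qed
  then have dec: "decseq a" by (simp add: decseq_Suc_iff)
  then obtain t where t: "a \<longlonglongrightarrow> t" "\<forall>m. t \<le> a m"
    using decseq_convergent[of a 0] a_nonneg by blast
  have "t \<le> 0"
  proof (rule ccontr)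
    assume "\<not> t \<le> 0"
    \<comment> \<open>A positive limit \<open>t\<close> is a lower bound of the decreasing sequence,
      yet a term close to \<open>t\<close> would push its successor below \<open>t\<close>.\<close>
    then obtain \<delta> where \<delta>: "\<delta> > 0" "\<forall>m. a m < t + \<delta> \<longrightarrow> a (Suc m) < t"
      using a_step[of t] by auto
    have "\<forall>\<^sub>F m in sequentially. a m < t + \<delta>"
      using t(1) \<delta>(1) by (intro order_tendstoD(2)[where y = t]) auto
    then obtain m where "a m < t + \<delta>" by (auto simp: eventually_sequentially)
    then show False using \<delta>(2) t(2) by (meson not_le)
  qed
  moreover have "t \<ge> 0" using t(1) a_nonneg by (meson LIMSEQ_le_const)
  ultimately have a0: "a \<longlonglongrightarrow> 0" using t(1) by simp
  obtain \<delta> where \<delta>: "\<delta> > 0"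
    "\<And>m k. m \<le> k \<Longrightarrow> D (z m) (z k) < \<epsilon>/2 + \<delta> \<Longrightarrow> D (z (Suc m)) (z (Suc k)) < \<epsilon>/2"
    using MK[of "\<epsilon>/2"] \<open>\<epsilon> > 0\<close> by auto
  \<comment> \<open>The bound by \<open>\<delta>\<close> makes the Meir-Keeler step apply on the
    whole trapping ball; the bound by \<open>\<epsilon>/2\<close> keeps its radius at most
    \<open>\<epsilon>\<close>.\<close>
  define \<eta> where "\<eta> = min \<delta> (\<epsilon>/2)"
  have \<eta>: "\<eta> > 0" "\<eta> \<le> \<delta>" "\<eta> \<le> \<epsilon>/2" using \<delta>(1) \<open>\<epsilon> > 0\<close> by (auto simp: \<eta>_def)
  have "\<forall>\<^sub>F m in sequentially. a m < \<eta>" using a0 \<eta>(1) by (rule order_tendstoD(2))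
  then obtain N where N: "a N < \<eta>" by (auto simp: eventually_sequentially)
  \<comment> \<open>Invariance of the ball: one step of the map shrinks the distance below
    \<open>\<epsilon>/2\<close>, and returning from \<open>z (Suc N)\<close> to \<open>z N\<close>
    costs less than \<open>\<eta>\<close>.\<close>
  have "D (z N) (z k) < \<epsilon>/2 + \<eta>" if "N \<le> k" for k
    using that
  proof (induction k rule: dec_induct)
    case base
    then show ?case using \<eta>(1) \<open>\<epsilon> > 0\<close> by (simp add: refl)
  next
    case (step k)
    then have "D (z (Suc N)) (z (Suc k)) < \<epsilon>/2" using \<delta>(2)[of N k] \<eta>(2) by simp
    then show ?case
      using triangle[of "z N" "z (Suc k)" "z (Suc N)"] N by (simp add: a_def)
  qed
  then show ?thesis using \<eta>(3) by fastforce
qed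

section \<open>Monotonicity for the product order\<close>

lemma mixed_le_swap: "mixed_le B A x y \<longleftrightarrow> mixed_le A B y x"
  by (auto simp: mixed_le_def)

text \<open>The coordinates of \<open>x\<close> are replaced by those of \<open>y\<close> one at a
  time; \<open>S\<close> collects those already replaced.\<close>

lemma mixed_monotone_le:
  fixes F :: "('n::finite \<Rightarrow> 'a::order) \<Rightarrow> 'a"
  assumes mono: "mixed_monotone A B F" and un: "A \<union> B = UNIV" and le: "mixed_le A B x y"
  shows "F x \<le> F y"
proof -
  have "F x \<le> F (\<lambda>i. if i \<in> S then y i else x i)" if "finite S" for S
    using that
  proof (induction S)
    case empty
    then show ?case by simp
  next
    case (insert j S)
    define w where "w = (\<lambda>i. if i \<in> S then y i else x i)"
    have upd: "w(j := x j) = w" "(\<lambda>i. if i \<in> insert j S then y i else x i) = w(j := y j)"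
      using insert.hyps by (auto simp: w_def fun_eq_iff)
    have "F (w(j := x j)) \<le> F (w(j := y j))"
    proof (cases "j \<in> A")
      case True
      then show ?thesis using mono le by (auto simp: mixed_monotone_def mixed_le_def)
    next
      case False
      then have "j \<in> B" using un by auto
      then show ?thesis using mono le by (auto simp: mixed_monotone_def mixed_le_def)
    qed
    then show ?case using insert.IH unfolding upd w_def[symmetric] by simp
  qed
  from this[of UNIV] show ?thesis by simp
qed

text \<open>\<open>U_ops\<close> encodes a sign rule: a row with index in \<open>A\<close> preserves
  the two blocks and hence the order, while a row with index in \<open>B\<close> exchanges them and
  reverses it.\<close>

lemma star_map_mixed_mono:
  fixes F :: "('n::finite \<Rightarrow> 'a::order) \<Rightarrow> 'a"
  assumes "mixed_monotone A B F" "A \<union> B = UNIV" "star \<in> U_ops A B" "mixed_le A B x y"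
  shows "mixed_le A B (star_map star F x) (star_map star F y)"
proof -
  have "mixed_le A B (\<lambda>k. x (star i k)) (\<lambda>k. y (star i k))" if "i \<in> A" for i
    using that assms(3,4) by (auto simp: U_ops_def mixed_le_def)
  moreover have "mixed_le A B (\<lambda>k. y (star i k)) (\<lambda>k. x (star i k))" if "i \<in> B" for i
    using that assms(3,4) by (auto simp: U_ops_def mixed_le_def)
  ultimately show ?thesis
    using mixed_monotone_le[OF assms(1,2)] by (simp add: mixed_le_def[of A B "star_map star F x"] star_map_def)
qed

section \<open>Fixed points for a general product metric\<close>

text \<open>Treats mean and maximum together: \<open>dist_le\<close> and \<open>le_sum\<close> make
  convergence in \<open>D\<close> the same as coordinatewise convergence.\<close>

lemma product_contraction_fixed_point:
  fixes F :: "('n::finite \<Rightarrow> 'a::{metric_space, order}) \<Rightarrow> 'a"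
    and D :: "('n \<Rightarrow> 'a) \<Rightarrow> ('n \<Rightarrow> 'a) \<Rightarrow> real"
    and star :: "'n \<Rightarrow> 'n \<Rightarrow> 'n"
  defines "T \<equiv> star_map star F"
  assumes triangle: "\<And>x y w. D x w \<le> D x y + D y w"
    and dist_le: "\<And>x y i. dist (x i) (y i) \<le> K * D x y"
    and le_sum: "\<And>x y. D x y \<le> (\<Sum>i\<in>UNIV. dist (x i) (y i))"
    and K: "K > 0"
    and \<phi>: "\<phi> \<in> Omega"
    and contr: "\<And>x y. mixed_le A B x y \<Longrightarrow> D (T x) (T y) \<le> \<phi> (D x y)"
    and un: "A \<union> B = UNIV"
    and compl: "O_complete E" and ran: "range F \<subseteq> E"
    and mono: "\<And>x y. mixed_le A B x y \<Longrightarrow> mixed_le A B (T x) (T y)"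
    and cont: "O_continuous F \<or> MCB_property E"
    and x0: "mixed_le A B x0 (T x0)"
  shows "\<exists>x. star_fixed_point star F x"
proof -
  have nonneg: "0 \<le> D x y" for x y
    \<comment> \<open>\<open>undefined\<close> serves as an arbitrary coordinate.\<close>
    using dist_le[of x undefined y] K by (metis order_trans zero_le_dist zero_le_mult_iff not_less)
  have refl: "D x x = 0" for x
    using le_sum[of x x] nonneg[of x x] by simp
  have eq: "x = y" if "D x y = 0" for x y
    using dist_le[of x _ y] that by (auto simp: fun_eq_iff)
  have MK: "\<exists>\<delta>>0. \<forall>x y. mixed_le A B x y \<longrightarrow> D x y < \<epsilon> + \<delta> \<longrightarrow> D (T x) (T y) < \<epsilon>"
    if "\<epsilon> > 0" for \<epsilon>
  proof -
    obtain \<delta> where \<delta>: "\<delta> > 0" "\<And>r. 0 < r \<Longrightarrow> r < \<epsilon> + \<delta> \<Longrightarrow> \<phi> r < \<epsilon>"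
      using Omega_Meir_Keeler[OF \<phi> \<open>\<epsilon> > 0\<close>] by blast
    have "D (T x) (T y) < \<epsilon>" if "mixed_le A B x y" "D x y < \<epsilon> + \<delta>" for x y
    \<comment> \<open>Distance 0 is split off because \<open>\<phi>\<close> gives no useful bound
      there; the two points then coincide.\<close>
    proof (cases "D x y = 0")
      case True
      then show ?thesis using eq refl \<open>\<epsilon> > 0\<close> by metis
    next
      case False
      then have "0 < D x y" using nonneg[of x y] by simp
      then show ?thesis using \<delta>(2) contr that by (meson order_le_less_trans)
    qed
    then show ?thesis using \<delta>(1) by blast
  qed
  define z where "z m = (T ^^ m) x0" for m
  have zS: "z (Suc m) = T (z m)" for m by (simp add: z_def)
  have z_step: "mixed_le A B (z m) (z (Suc m))" for m
    by (induction m) (use x0 mono zS in \<open>auto simp: z_def\<close>)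
  have inc: "incseq (\<lambda>m. z m i)" if "i \<in> A" for i
    using z_step that by (auto intro: incseq_SucI simp: mixed_le_def)
  have dec: "decseq (\<lambda>m. z m i)" if "i \<in> B" for i
    using z_step that by (auto intro: decseq_SucI simp: mixed_le_def)
  have z_le: "mixed_le A B (z m) (z k)" if "m \<le> k" for m k
    using inc dec that by (auto simp: mixed_le_def incseq_def decseq_def)
  have z_mono: "monoseq (\<lambda>m. z m i)" for i
    using inc[of i] dec[of i] un by (auto simp: monoseq_iff)
  have Cauchy: "Cauchy (\<lambda>m. z m i)" for i
    unfolding Cauchy_altdef2
  proof (intro allI impI)
    fix e :: real assume "e > 0"
    then have eK: "e / K > 0" using K by simp
    have step: "\<exists>\<delta>>0. \<forall>m k. m \<le> k \<longrightarrow> D (z m) (z k) < \<epsilon> + \<delta> \<longrightarrow> D (z (Suc m)) (z (Suc k)) < \<epsilon>"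
      if "\<epsilon> > 0" for \<epsilon>
      using MK[OF that] z_le unfolding zS by blast
    obtain N where "\<forall>k\<ge>N. D (z N) (z k) < e / K"
      using Meir_Keeler_orbit_Cauchy[where D = D and z = z, OF nonneg refl triangle step eK] by blast
    then have "\<forall>k\<ge>N. K * D (z N) (z k) < e" using K by (simp add: field_simps)
    then show "\<exists>N. \<forall>n\<ge>N. dist (z n i) (z N i) < e"
      using dist_le by (metis dist_commute order_le_less_trans)
  qed
  \<comment> \<open>The start \<open>x0\<close> may lie outside \<open>E\<close>, so completeness
    and MCB are applied to the sequence shifted by one.\<close>
  have zE: "z (Suc m) i \<in> E" for m i
    using ran by (auto simp: zS T_def star_map_def)
  have "\<exists>l\<in>E. (\<lambda>m. z (Suc m) i) \<longlonglongrightarrow> l" for i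
  proof -
    have "monoseq (\<lambda>m. z (Suc m) i)"
      using z_mono[of i] by (auto simp: monoseq_def)
    moreover have "Cauchy (\<lambda>m. z (Suc m) i)"
      using Cauchy_subseq_Cauchy[OF Cauchy, of Suc] by (simp add: o_def strict_mono_Suc_iff)
    ultimately show ?thesis
      using compl[unfolded O_complete_def, rule_format, of "\<lambda>m. z (Suc m) i"] zE by blast
  qed
  then obtain l where l: "\<And>i. l i \<in> E" "\<And>i. (\<lambda>m. z (Suc m) i) \<longlonglongrightarrow> l i" by metis
  have lim: "(\<lambda>m. z m i) \<longlonglongrightarrow> l i" for i using l(2) by (rule LIMSEQ_imp_Suc)
  have "(\<lambda>m. z (Suc m) i) \<longlonglongrightarrow> T l i" for i
    using cont
  proof
    assume "O_continuous F"
    then show ?thesis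
      unfolding O_continuous_def zS T_def star_map_def
      \<comment> \<open>For fixed \<open>i\<close>, argument \<open>k\<close> of \<open>F\<close>
        runs along the coordinate sequence with index \<open>star i k\<close>.\<close>
      by (elim allE[of _ "\<lambda>k m. z m (star i k)"] allE[of _ "\<lambda>k. l (star i k)"]) (use z_mono lim in auto)
  next
    assume "MCB_property E"
    have *: "(incseq (\<lambda>m. z (Suc m) j) \<longrightarrow> (\<forall>m. z (Suc m) j \<le> l j)) \<and>
        (decseq (\<lambda>m. z (Suc m) j) \<longrightarrow> (\<forall>m. l j \<le> z (Suc m) j))" for j
      using \<open>MCB_property E\<close>[unfolded MCB_property_def, rule_format, of "l j" "\<lambda>m. z (Suc m) j"] l zE
      by blast
    have z_le_l: "mixed_le A B (z (Suc m)) l" for m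
      using * inc dec by (simp add: mixed_le_def incseq_Suc_iff decseq_Suc_iff)
    have "(\<lambda>m. \<Sum>i\<in>UNIV. dist (z (Suc m) i) (l i)) \<longlonglongrightarrow> 0"
      by (intro tendsto_null_sum tendsto_dist_iff[THEN iffD1] l(2))
    then have D0: "(\<lambda>m. D (z (Suc m)) l) \<longlonglongrightarrow> 0"
      by (rule Lim_null_comparison[rotated]) (simp add: nonneg le_sum)
    \<comment> \<open>The second shift arises from applying \<open>T\<close> to
      \<open>z (Suc m)\<close>, which is comparable to \<open>l\<close>, so that \<open>MK\<close>
      bounds the distance to \<open>T l\<close>.\<close>
    have "(\<lambda>m. z (Suc (Suc m)) i) \<longlonglongrightarrow> T l i"
      unfolding tendsto_iff
    proof (intro allI impI)
      fix e :: real assume "e > 0"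
      then have eK: "e / K > 0" using K by simp
      then obtain \<delta> where \<delta>: "\<delta> > 0"
        "\<And>x y. mixed_le A B x y \<Longrightarrow> D x y < e / K + \<delta> \<Longrightarrow> D (T x) (T y) < e / K"
        using MK by blast
      have "\<forall>\<^sub>F m in sequentially. D (z (Suc m)) l < e / K + \<delta>"
        using D0 \<delta>(1) eK by (intro order_tendstoD(2)) auto
      then show "\<forall>\<^sub>F m in sequentially. dist (z (Suc (Suc m)) i) (T l i) < e"
      proof (rule eventually_mono)
        fix m assume "D (z (Suc m)) l < e / K + \<delta>"
        then have "K * D (z (Suc (Suc m))) (T l) < e"
          using \<delta>(2)[OF z_le_l] K by (simp add: zS field_simps)
        then show "dist (z (Suc (Suc m)) i) (T l i) < e"
          using dist_le by (rule order_le_less_trans[rotated])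
      qed
    qed
    then show ?thesis by (rule LIMSEQ_imp_Suc)
  qed
  then have "T l i = l i" for i using l(2) LIMSEQ_unique by blast
  then show ?thesis unfolding T_def star_map_def star_fixed_point_def by blast
qed

section \<open>Specialization to mean and maximum\<close>

theorem theorem8:
  fixes F :: "('n::finite \<Rightarrow> 'a::{metric_space, order}) \<Rightarrow> 'a"
    and star :: "'n \<Rightarrow> 'n \<Rightarrow> 'n"
    and A B :: "'n set"
    and E :: "'a set"
  assumes "CARD('n) \<ge> 2"
    and "index_partition A B"
    and "star \<in> U_ops A B"
    and "E \<noteq> {}" and "O_complete E"
    and "range F \<subseteq> E"
    and "mixed_monotone A B F"
    and "O_continuous F \<or> MCB_property E"
    and "\<exists>x0. mixed_le A B x0 (star_map star F x0) \<or> mixed_le A B (star_map star F x0) x0"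
    and "(\<exists>\<phi>\<in>Omega. \<forall>x y. mixed_le A B x y \<or> mixed_le A B y x \<longrightarrow>
            (1 / real CARD('n)) * (\<Sum>i\<in>UNIV. dist (star_map star F x i) (star_map star F y i))
              \<le> \<phi> ((1 / real CARD('n)) * (\<Sum>i\<in>UNIV. dist (x i) (y i))))
       \<or> (\<exists>\<phi>\<in>Omega. \<forall>x y. mixed_le A B x y \<or> mixed_le A B y x \<longrightarrow>
            (MAX i. dist (star_map star F x i) (star_map star F y i))
              \<le> \<phi> (MAX i. dist (x i) (y i)))"
  shows "\<exists>x. star_fixed_point star F x"
proof -
  let ?T = "star_map star F"
  have un: "A \<union> B = UNIV" using assms(2) by (simp add: index_partition_def)
  have mono: "mixed_le A B (?T x) (?T y)" if "mixed_le A B x y" for x y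
    using star_map_mixed_mono[OF assms(7) un assms(3) that] .
  have fixed_point: ?thesis
    if D: "\<And>x y w. D x w \<le> D x y + D y w"
      "\<And>x y i. dist (x i) (y i) \<le> K * D x y"
      "\<And>x y. D x y \<le> (\<Sum>i\<in>UNIV. dist (x i) (y i))" "K > 0" "\<phi> \<in> Omega"
      and contr: "\<And>x y. mixed_le A B x y \<or> mixed_le A B y x \<Longrightarrow> D (?T x) (?T y) \<le> \<phi> (D x y)"
    for D :: "('n \<Rightarrow> 'a) \<Rightarrow> ('n \<Rightarrow> 'a) \<Rightarrow> real" and K \<phi>
  proof -
    obtain x0 where "mixed_le A B x0 (?T x0) \<or> mixed_le A B (?T x0) x0" using assms(9) by blast
    then show ?thesis
    proof
      assume x0: "mixed_le A B x0 (?T x0)"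
      show ?thesis
        by (rule product_contraction_fixed_point[where D = D, OF D contr[OF disjI1] un assms(5,6) mono assms(8) x0])
    next
      assume "mixed_le A B (?T x0) x0"
      \<comment> \<open>Exchanging \<open>A\<close> and \<open>B\<close> reverses the product order
        and reduces this case to the previous one.\<close>
      then have x0: "mixed_le B A x0 (?T x0)" by (simp only: mixed_le_swap[of B A])
      have un': "B \<union> A = UNIV" using un by auto
      have mono': "mixed_le B A (?T x) (?T y)" if "mixed_le B A x y" for x y
        using mono that by (simp only: mixed_le_swap[of B A])
      have contr': "D (?T x) (?T y) \<le> \<phi> (D x y)" if "mixed_le B A x y" for x y
        using contr[of x y] that by (simp only: mixed_le_swap[of B A] simp_thms)
      show ?thesis
        by (rule product_contraction_fixed_point[where D = D, OF D contr' un' assms(5,6) mono' assms(8) x0])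
    qed
  qed
  have n: "real CARD('n) \<ge> 1" by (simp add: Suc_leI)
  have dist_le_sum: "dist (x i) (y i) \<le> (\<Sum>i\<in>UNIV. dist (x i) (y i))" for x y :: "'n \<Rightarrow> 'a" and i
    by (rule member_le_sum) auto
  from assms(10) show ?thesis
  proof (elim disjE bexE)
    fix \<phi>
    let ?D = "\<lambda>x y :: 'n \<Rightarrow> 'a. (1 / real CARD('n)) * (\<Sum>i\<in>UNIV. dist (x i) (y i))"
    assume \<phi>: "\<phi> \<in> Omega" and contr: "\<forall>x y. mixed_le A B x y \<or> mixed_le A B y x \<longrightarrow>
        ?D (?T x) (?T y) \<le> \<phi> (?D x y)"
    show ?thesis
    \<comment> \<open>One distance is at most the sum, which is \<open>CARD('n)\<close> times the
      mean.\<close>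
    proof (rule fixed_point[where D = ?D and K = "real CARD('n)", OF _ _ _ _ \<phi>])
      show "?D x w \<le> ?D x y + ?D y w" for x y w
        using sum_mono[of UNIV "\<lambda>i. dist (x i) (w i)" "\<lambda>i. dist (x i) (y i) + dist (y i) (w i)"] n
        by (simp add: dist_triangle sum.distrib divide_right_mono flip: add_divide_distrib)
      show "?D x y \<le> (\<Sum>i\<in>UNIV. dist (x i) (y i))" for x y
        using n by (intro mult_left_le_one_le) (auto simp: sum_nonneg)
    qed (use n contr dist_le_sum in auto)
  next
    fix \<phi>
    let ?D = "\<lambda>x y :: 'n \<Rightarrow> 'a. MAX i. dist (x i) (y i)"
    assume \<phi>: "\<phi> \<in> Omega" and contr: "\<forall>x y. mixed_le A B x y \<or> mixed_le A B y x \<longrightarrow>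
        ?D (?T x) (?T y) \<le> \<phi> (?D x y)"
    have dist_le_Max: "dist (x i) (y i) \<le> ?D x y" for x y i by (rule Max_ge) auto
    show ?thesis
    proof (rule fixed_point[where D = ?D and K = 1, OF _ _ _ _ \<phi>])
      show "?D x w \<le> ?D x y + ?D y w" for x y w
      proof (rule Max.boundedI)
        fix d assume "d \<in> range (\<lambda>i. dist (x i) (w i))"
        then obtain i where "d = dist (x i) (w i)" by auto
        then show "d \<le> ?D x y + ?D y w"
          using dist_triangle[of "x i" "w i" "y i"] dist_le_Max[of x i y] dist_le_Max[of y i w] by linarith
      qed auto
      show "?D x y \<le> (\<Sum>i\<in>UNIV. dist (x i) (y i))" for x y
        using dist_le_sum by (intro Max.boundedI) auto
    qed (use contr dist_le_Max in auto)
  qed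
qed

end
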